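(* Write $f(k,m,n)=f_{\text{1--2--1'}}(k,m,n)$. Then: (i) $f(0,m,n)=\binom{n-1}{m-1}$ for $n\ge1$ and $1\le m\le n$; (ii) $f(1,m,n)=\binom{n-2}{m-1}$ for $n\ge3$ and $1\le m\le n-1$; (iii) $f(2,m,n)=2\binom{n-2}{m-1}$ for $n\ge4$ and $1\le m\le n-1$.
   Context: The standard cycle form of $\pi\in\mathcal S_n$ writes each cycle starting with its smallest element, cycles listed in decreasing order of smallest elements; $\Psi(\pi)$ is the word obtained by deleting the parentheses. A cyclic occurrence of the partially ordered pattern 1--2--1' in $\pi$ is a triple of indices $i<j<k$ with $w_j>w_i$ and $w_j>w_k$, where $w=\Psi(\pi)$ (no condition relating $w_i$ and $w_k$); equivalently an occurrence of 1--3--2 or of 2--3--1. $f_{\text{1--2--1'}}(k,m,n)$ is the number of $\pi\in\mathcal S_n$ with $m$ cycles and exactly $k$ cyclic occurrences of 1--2--1'. *)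

theory Defs
  imports "HOL-Combinatorics.Orbits" "HOL-Combinatorics.Cycles"
begin

definition cycle_sets :: "nat \<Rightarrow> (nat \<Rightarrow> nat) \<Rightarrow> nat set set" where
  "cycle_sets n \<pi> = orbit \<pi> ` {1..n}"

(* support \<pi> a is the list [a, \<pi> a, \<pi> (\<pi> a), ...] running once around the cycle of a;
   fixed points give singleton lists. *)
definition standard_cycle_form :: "nat \<Rightarrow> (nat \<Rightarrow> nat) \<Rightarrow> nat list list" where
  "standard_cycle_form n \<pi> = map (support \<pi>) (rev (sorted_list_of_set (Min ` cycle_sets n \<pi>)))"

definition Psi :: "nat \<Rightarrow> (nat \<Rightarrow> nat) \<Rightarrow> nat list" where
  "Psi n \<pi> = concat (standard_cycle_form n \<pi>)"

definition occurrences_121' :: "nat list \<Rightarrow> (nat \<times> nat \<times> nat) set" where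
  "occurrences_121' w =
     {(i, j, k). i < j \<and> j < k \<and> k < length w \<and> w ! j > w ! i \<and> w ! j > w ! k}"

definition f_121' :: "nat \<Rightarrow> nat \<Rightarrow> nat \<Rightarrow> nat" where
  "f_121' k m n =
     card {\<pi>. \<pi> permutes {1..n} \<and> card (cycle_sets n \<pi>) = m \<and>
              card (occurrences_121' (Psi n \<pi>)) = k}"

end

theory Submission
  imports Defs
begin

text \<open>
  Every permutation of \<open>{1..n+1}\<close> arises uniquely from a permutation \<open>p\<close> of \<open>{1..n}\<close>, either by adding
  \<open>n+1\<close> as a fixed point or by inserting it into a cycle directly after some \<open>a\<close>. On words the former
  prepends \<open>n+1\<close> to \<open>\<Psi>(p)\<close> and adds a cycle; the latter inserts \<open>n+1\<close> directly after the letter \<open>a\<close>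
  and keeps the cycle minima. A maximal letter with \<open>u\<close> letters before it and \<open>v\<close> after it is the
  middle of exactly \<open>u v\<close> occurrences and takes part in no others. Hence, with \<open>y\<close> marking cycles
  and \<open>x\<close> marking occurrences, the generating function for \<open>n\<close> is multiplied by
  \<open>y + (\<Sum>a=1..n. x^(a(n-a)))\<close>, which is \<open>y + 1\<close> up to terms of \<open>x\<close>-degree at least \<open>n-1\<close>.
\<close>

section \<open>Inserting a letter into a word\<close>

text \<open>The place of insertion is given by a letter, not by a position, so that the operation
  commutes with concatenation and can be applied to each cycle of a standard form separately. On a
  distinct word containing \<open>a\<close> it inserts exactly once.\<close>

definition insert_after :: "'a \<Rightarrow> 'a \<Rightarrow> 'a list \<Rightarrow> 'a list" where
  "insert_after a x w = concat (map (\<lambda>y. if y = a then [y, x] else [y]) w)"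

lemma insert_after_Nil [simp]: "insert_after a x [] = []"
  and insert_after_Cons [simp]:
    "insert_after a x (y # w) = (if y = a then y # x # insert_after a x w else y # insert_after a x w)"
  and insert_after_append [simp]:
    "insert_after a x (v @ w) = insert_after a x v @ insert_after a x w"
  by (simp_all add: insert_after_def)

lemma insert_after_concat: "insert_after a x (concat ws) = concat (map (insert_after a x) ws)"
  by (induction ws) simp_all

lemma insert_after_notin [simp]: "a \<notin> set w \<Longrightarrow> insert_after a x w = w"
  by (induction w) auto

lemma set_insert_after: "set (insert_after a x w) = (if a \<in> set w then insert x (set w) else set w)"
  by (induction w) auto

lemma distinct_insert_after:
  "distinct w \<Longrightarrow> x \<notin> set w \<Longrightarrow> distinct (insert_after a x w)"
  by (induction w) (auto simp: set_insert_after split: if_splits)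

text \<open>Passes from letters to positions: cycles determine the letter preceding the new one,
  whereas counting occurrences needs the number of letters on either side.\<close>

lemma insert_after_nth:
  assumes "distinct w" "i < length w"
  shows "insert_after (w ! i) x w = take (Suc i) w @ x # drop (Suc i) w"
proof -
  have w: "w = take i w @ w ! i # drop (Suc i) w"
    using assms(2) by (rule id_take_nth_drop)
  have "distinct (take i w @ w ! i # drop (Suc i) w)"
    using w assms(1) by simp
  then have "insert_after (w ! i) x (take i w @ w ! i # drop (Suc i) w)
      = take i w @ w ! i # x # drop (Suc i) w"
    by simp
  then show ?thesis
    using w assms(2) by (simp add: take_Suc_conv_app_nth)
qed

section \<open>Cycles as lists\<close>

text \<open>A local description of \<open>support\<close>: only neighbouring letters and the closing
  step are compared, so it can be checked on a modified list without computing
  \<open>least_power\<close>.\<close>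

definition is_cycle_list :: "('a \<Rightarrow> 'a) \<Rightarrow> 'a list \<Rightarrow> bool" where
  "is_cycle_list p xs \<longleftrightarrow>
     xs \<noteq> [] \<and> distinct xs \<and> successively (\<lambda>x y. p x = y) xs \<and> p (last xs) = hd xs"

lemma successively_funpow:
  assumes "successively (\<lambda>x y. p x = y) xs" "i < length xs"
  shows "(p ^^ i) (hd xs) = xs ! i"
  using assms
proof (induction xs arbitrary: i)
  case (Cons x xs)
  show ?case
  proof (cases i)
    case (Suc j)
    then have "xs \<noteq> []" using Cons.prems by auto
    then have "p x = hd xs" "successively (\<lambda>x y. p x = y) xs"
      using Cons.prems by (auto simp: successively_Cons)
    then have "(p ^^ j) (p x) = xs ! j"
      using Cons Suc by auto
    then show ?thesis
      using Suc by (simp del: funpow.simps add: funpow_Suc_right)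
  qed simp
qed simp

text \<open>Entry \<open>i\<close> of the list is the \<open>i\<close>-th iterate of its head.
  Distinctness excludes an earlier return, so the first return to the head happens at the length of
  the list, which is therefore \<open>least_power\<close>.\<close>

lemma support_hd_is_cycle_list:
  assumes "is_cycle_list p xs"
  shows "support p (hd xs) = xs"
proof -
  have xs: "xs \<noteq> []" "distinct xs" and *: "\<And>i. i < length xs \<Longrightarrow> (p ^^ i) (hd xs) = xs ! i"
    and last: "p (last xs) = hd xs"
    using assms successively_funpow[of p xs] by (auto simp: is_cycle_list_def)
  have "least_power p (hd xs) = length xs"
    unfolding least_power_def
  proof (rule Least_equality)
    obtain l where l: "length xs = Suc l" using xs by (cases xs) auto
    have "(p ^^ length xs) (hd xs) = p (xs ! l)"
      using *[of l] l by simp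
    also have "xs ! l = last xs" using l xs by (simp add: last_conv_nth)
    finally show "(p ^^ length xs) (hd xs) = hd xs \<and> length xs > 0"
      using last xs by simp
  next
    fix i assume i: "(p ^^ i) (hd xs) = hd xs \<and> 0 < i"
    show "length xs \<le> i"
    proof (rule ccontr)
      assume "\<not> length xs \<le> i"
      then have "xs ! i = xs ! 0" using * i xs by (simp add: hd_conv_nth)
      then show False using i xs \<open>\<not> length xs \<le> i\<close> by (simp add: nth_eq_iff_index_eq)
    qed
  qed
  then show ?thesis
    by (intro nth_equalityI) (simp_all add: *)
qed

lemma support_nonempty:
  "permutation p \<Longrightarrow> support p a \<noteq> []" 
  using least_power_of_permutation(2)[of p a] by auto

lemma hd_support: "permutation p \<Longrightarrow> hd (support p a) = a"
  using least_power_of_permutation(2)[of p a] by (simp add: hd_map)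

lemma is_cycle_list_support:
  assumes "permutation p"
  shows "is_cycle_list p (support p a)"
proof -
  have succ: "successively (\<lambda>x y. p x = y) (map (\<lambda>i. (p ^^ i) a) [0..<k])" for k
  proof (induction k)
    case (Suc k)
    then show ?case by (cases k) (auto simp: successively_append_iff)
  qed simp
  obtain l where l: "least_power p a = Suc l"
    using least_power_of_permutation(2)[OF assms, of a] gr0_conv_Suc by auto
  have "p (last (support p a)) = a"
    using least_power_of_permutation(1)[OF assms, of a] l by simp
  then show ?thesis
    using succ support_nonempty[OF assms] hd_support[OF assms] cycle_of_permutation[OF assms]
    by (simp add: is_cycle_list_def)
qed

lemma set_support_eq_orbit:
  assumes "permutation p"
  shows "set (support p a) = orbit p a"
  using support_set[OF assms] orbit_altdef_permutation[OF assms] by auto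

text \<open>The composite sends \<open>a\<close> to \<open>N\<close> and \<open>N\<close> to
  \<open>p a\<close>, and agrees with \<open>p\<close> elsewhere. The old cycle with
  \<open>N\<close> spliced in after \<open>a\<close> is thus a cycle list of the composite with the
  same head, and a cycle list is determined by its head.\<close>

lemma support_comp_transpose:
  assumes p: "permutation p" and N: "N \<notin> orbit p c" and aN: "a \<noteq> N" and pN: "p N = N"
  shows "support (p \<circ> transpose N a) c = insert_after a N (support p c)"
proof -
  define q where "q = p \<circ> transpose N a"
  define xs where "xs = support p c"
  have xs: "is_cycle_list p xs" and hd: "hd xs = c" and Nxs: "N \<notin> set xs"
    using is_cycle_list_support[OF p] hd_support[OF p] N set_support_eq_orbit[OF p]
    unfolding xs_def by metis+
  have q: "q a = N" "q N = p a" "\<And>x. x \<noteq> a \<Longrightarrow> x \<noteq> N \<Longrightarrow> q x = p x"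
    using pN by (auto simp: q_def transpose_def)
  have same: "successively (\<lambda>x y. q x = y) ys" if "successively (\<lambda>x y. p x = y) ys"
      "a \<notin> set ys" "N \<notin> set ys" for ys
    using that(1) by (rule successively_mono) (use that q(3) in metis)
  have "is_cycle_list q (insert_after a N xs) \<and> hd (insert_after a N xs) = c"
  proof (cases "a \<in> set xs")
    case False
    moreover have "last xs \<in> set xs" using xs by (simp add: is_cycle_list_def)
    then have "last xs \<noteq> a" "last xs \<noteq> N" using False Nxs by auto
    ultimately show ?thesis
      using xs hd Nxs same[of xs] q(3)[of "last xs"]
      by (auto simp: is_cycle_list_def)
  next
    case True
    then obtain us vs where uv: "xs = us @ a # vs" by (auto dest: split_list)
    then have nin: "a \<notin> set us" "a \<notin> set vs" "N \<notin> set us" "N \<notin> set vs" and "distinct xs"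
      using xs Nxs by (auto simp: is_cycle_list_def)
    have ins: "insert_after a N xs = us @ a # N # vs" using uv nin by simp
    have su: "successively (\<lambda>x y. p x = y) us" "successively (\<lambda>x y. p x = y) vs"
      "us \<noteq> [] \<Longrightarrow> p (last us) = a" "vs \<noteq> [] \<Longrightarrow> p a = hd vs"
      and l: "p (last xs) = c"
      using xs hd unfolding is_cycle_list_def uv
      by (auto simp: successively_append_iff successively_Cons)
    have "us \<noteq> [] \<Longrightarrow> q (last us) = a" 
      using su(3) q(3)[of "last us"] nin last_in_set[of us] by metis
    moreover have "vs \<noteq> [] \<Longrightarrow> q (last vs) = c"
      using l q(3)[of "last vs"] nin last_in_set[of vs] uv by (metis last.simps last_append list.distinct(1))
    \<comment> \<open>If \<open>a\<close> ends the list, then \<open>N\<close> becomes the last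
      entry and has to close the cycle.\<close>
    moreover have "vs = [] \<Longrightarrow> q N = c" using l uv q(2) by simp
    moreover have "hd (us @ a # N # vs) = c" using hd uv by (cases us) auto
    ultimately show ?thesis
      unfolding ins is_cycle_list_def
      using same[OF su(1)] same[OF su(2)] nin su(4) q aN \<open>distinct xs\<close> uv
      by (auto simp: successively_append_iff successively_Cons)
  qed
  then show ?thesis
    using support_hd_is_cycle_list[of q "insert_after a N xs"] unfolding q_def xs_def by simp
qed


section \<open>Effect of a new maximum on cycles and on \<Psi>\<close>

lemma cycle_sets_fixed_max:
  assumes "p permutes {1..n}"
  shows "cycle_sets (Suc n) p = insert {Suc n} (cycle_sets n p)"
proof -
  have "p (Suc n) = Suc n" using assms by (rule permutes_not_in) simp
  then have "orbit p (Suc n) = {Suc n}" by (simp add: orbit_eq_singleton_iff)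
  moreover have "{1..Suc n} = insert (Suc n) {1..n}" by auto
  ultimately show ?thesis by (simp add: cycle_sets_def)
qed

lemma cycle_sets_subset:
  assumes "p permutes {1..n}" "C \<in> cycle_sets n p"
  shows "C \<subseteq> {1..n}" "finite C" "C \<noteq> {}" "Min C \<in> {1..n}"
proof -
  obtain c where c: "c \<in> {1..n}" "C = orbit p c"
    using assms(2) by (auto simp: cycle_sets_def)
  show *: "C \<subseteq> {1..n}" using permutes_orbit_subset[OF assms(1) c(1)] c by simp
  show **: "finite C" using * finite_subset by blast
  show ***: "C \<noteq> {}" using orbit_nonempty c by simp
  show "Min C \<in> {1..n}" using * ** *** Min_in by blast
qed

lemma finite_cycle_sets [simp]: "finite (cycle_sets n p)"
  by (simp add: cycle_sets_def)

text \<open>The new fixed point is the largest cycle minimum, so its one-letter cycle comes first in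
  the decreasing order.\<close>

lemma Psi_fixed_max:
  assumes "p permutes {1..n}"
  shows "Psi (Suc n) p = Suc n # Psi n p"
proof -
  let ?M = "Min ` cycle_sets n p"
  have M: "Min ` cycle_sets (Suc n) p = insert (Suc n) ?M"
    using cycle_sets_fixed_max[OF assms] by simp
  have lt: "\<forall>x\<in>?M. x < Suc n" using cycle_sets_subset(4)[OF assms] by fastforce
  have "sorted_list_of_set (insert (Suc n) ?M) = sorted_list_of_set ?M @ [Suc n]"
  proof (rule strict_sorted_equal)
    show "sorted_wrt (<) (sorted_list_of_set (insert (Suc n) ?M))"
      by (rule strict_sorted_list_of_set)
    show "sorted_wrt (<) (sorted_list_of_set ?M @ [Suc n])"
      using lt by (simp add: sorted_wrt_append)
    show "set (sorted_list_of_set (insert (Suc n) ?M)) = set (sorted_list_of_set ?M @ [Suc n])"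
      by (simp del: sorted_list_of_set_insert_remove)
  qed
  moreover have "p (Suc n) = Suc n" using assms by (rule permutes_not_in) simp
  then have "support p (Suc n) = [Suc n]"
    using support_hd_is_cycle_list[of p "[Suc n]"] by (simp add: is_cycle_list_def)
  ultimately show ?thesis
    unfolding Psi_def standard_cycle_form_def M by simp
qed

lemma permutes_insert_max:
  assumes "p permutes {1..n}" "a \<in> {1..n}"
  shows "p \<circ> transpose (Suc n) a permutes {1..Suc n}"
  by (rule permutes_compose[OF permutes_swap_id])
    (use assms permutes_subset[OF assms(1), of "{1..Suc n}"] in auto)

lemma cycle_sets_insert_max:
  assumes p: "p permutes {1..n}" and a: "a \<in> {1..n}"
  shows "cycle_sets (Suc n) (p \<circ> transpose (Suc n) a) =
    (\<lambda>C. if a \<in> C then insert (Suc n) C else C) ` cycle_sets n p"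
proof -
  define q where "q = p \<circ> transpose (Suc n) a"
  have pp: "permutation p" using p permutation_permutes by blast
  have pq: "permutation q"
    using permutes_insert_max[OF p a] permutation_permutes unfolding q_def by blast
  have pN: "p (Suc n) = Suc n" using p by (rule permutes_not_in) simp
  have o: "orbit q c = (if a \<in> orbit p c then insert (Suc n) (orbit p c) else orbit p c)"
    if "c \<in> {1..n}" for c
  proof -
    have "Suc n \<notin> orbit p c" using permutes_orbit_subset[OF p that] by auto
    then have "support q c = insert_after a (Suc n) (support p c)"
      unfolding q_def using pN a by (intro support_comp_transpose[OF pp]) auto
    then have "set (support q c) = set (insert_after a (Suc n) (support p c))" by (rule arg_cong)
    then show ?thesis
      unfolding set_insert_after set_support_eq_orbit[OF pp] set_support_eq_orbit[OF pq] .
  qed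
  \<comment> \<open>The orbit of \<open>Suc n\<close> is that of \<open>a\<close>, so the orbits of
    \<open>1..n\<close> already give all cycles.\<close>
  have "q a = Suc n" using pN by (simp add: q_def)
  then have "Suc n \<in> orbit q a" using orbit.base[of q a] by simp
  then have "orbit q (Suc n) = orbit q a"
    using orbit_cyclic_eq3[OF cyclic_on_orbit'[OF pq]] by blast
  moreover have "{1..Suc n} = insert (Suc n) {1..n}" by auto
  ultimately have "orbit q ` {1..Suc n} = orbit q ` {1..n}" using a by (simp add: insert_absorb)
  also have "\<dots> = (\<lambda>C. if a \<in> C then insert (Suc n) C else C) ` orbit p ` {1..n}"
    unfolding image_image by (rule image_cong) (simp_all add: o)
  finally show ?thesis unfolding cycle_sets_def q_def .
qed

text \<open>No old cycle contains \<open>Suc n\<close>, so each one is recovered from its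
  enlargement and no two become equal.\<close>

lemma card_cycle_sets_insert_max:
  assumes p: "p permutes {1..n}" and a: "a \<in> {1..n}"
  shows "card (cycle_sets (Suc n) (p \<circ> transpose (Suc n) a)) = card (cycle_sets n p)"
  unfolding cycle_sets_insert_max[OF p a]
proof (rule card_image, rule inj_onI)
  fix C D assume "C \<in> cycle_sets n p" "D \<in> cycle_sets n p"
    and eq: "(if a \<in> C then insert (Suc n) C else C) = (if a \<in> D then insert (Suc n) D else D)"
  then have "Suc n \<notin> C" "Suc n \<notin> D" using cycle_sets_subset(1)[OF p] by fastforce+
  then show "C = D" using eq by (metis insertI1 insert_ident)
qed

text \<open>A new maximum in an existing cycle never becomes its minimum. Hence the starting letters
  and the order of the cycles persist, and only the cycle through \<open>a\<close> grows.\<close>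

lemma Psi_insert_max:
  assumes p: "p permutes {1..n}" and a: "a \<in> {1..n}"
  shows "Psi (Suc n) (p \<circ> transpose (Suc n) a) = insert_after a (Suc n) (Psi n p)"
proof -
  define q where "q = p \<circ> transpose (Suc n) a"
  have pp: "permutation p" using p permutation_permutes by blast
  have pN: "p (Suc n) = Suc n" using p by (rule permutes_not_in) simp
  have s: "support q c = insert_after a (Suc n) (support p c)" if "c \<in> {1..n}" for c
  proof -
    have "Suc n \<notin> orbit p c" using permutes_orbit_subset[OF p that] by auto
    then show ?thesis
      unfolding q_def using pN a by (intro support_comp_transpose[OF pp]) auto
  qed
  have M: "Min ` cycle_sets (Suc n) q = Min ` cycle_sets n p"
    unfolding q_def cycle_sets_insert_max[OF p a] image_image
  proof (rule image_cong[OF refl])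
    fix C assume C: "C \<in> cycle_sets n p"
    show "Min (if a \<in> C then insert (Suc n) C else C) = Min C"
      using cycle_sets_subset[OF p C] by auto
  qed
  have "map (support q) (rev (sorted_list_of_set (Min ` cycle_sets n p))) =
    map (insert_after a (Suc n)) (map (support p) (rev (sorted_list_of_set (Min ` cycle_sets n p))))"
    using s cycle_sets_subset(4)[OF p] unfolding map_map by (intro map_cong) auto
  then have "Psi (Suc n) q = insert_after a (Suc n) (Psi n p)"
    unfolding Psi_def standard_cycle_form_def insert_after_concat M by (rule arg_cong)
  then show ?thesis unfolding q_def .
qed

section \<open>Decomposing permutations by their maximal point\<close>

text \<open>If \<open>q\<close> moves \<open>Suc n\<close>, composing it with the transposition of
  \<open>Suc n\<close> and its preimage \<open>a\<close> makes \<open>Suc n\<close> fixed. A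
  transposition is its own inverse, so \<open>q\<close> is regained by the same composition.\<close>

lemma permutes_Suc_cases:
  assumes q: "q permutes {1..Suc n}"
  obtains "q permutes {1..n}"
  | p a where "p permutes {1..n}" "a \<in> {1..n}" "q = p \<circ> transpose (Suc n) a"
proof (cases "q (Suc n) = Suc n")
  case True
  have "q permutes {1..n}"
    by (rule permutes_superset[OF q]) (use True in \<open>auto simp: le_Suc_eq\<close>)
  then show ?thesis by (rule that(1))
next
  case False
  define a where "a = inv q (Suc n)"
  have qa: "q a = Suc n" unfolding a_def using permutes_inverses(1)[OF q] .
  have a: "a \<in> {1..n}"
    using False qa permutes_in_image[OF q, of a] by (auto simp: le_Suc_eq)
  define p where "p = q \<circ> transpose (Suc n) a"
  have "p permutes {1..Suc n}" unfolding p_def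
    by (rule permutes_compose[OF permutes_swap_id q]) (use a in auto)
  then have "p permutes {1..n}"
    by (rule permutes_superset) (use qa in \<open>auto simp: p_def le_Suc_eq\<close>)
  moreover have "q = p \<circ> transpose (Suc n) a" by (simp add: p_def comp_assoc)
  ultimately show ?thesis using a that(2) by blast
qed

text \<open>Induction along the insertion of the maximum replaces a direct argument that the cycles
  partition \<open>{1..n}\<close>.\<close>

lemma Psi_enumerates:
  assumes "p permutes {1..n}"
  shows "distinct (Psi n p) \<and> set (Psi n p) = {1..n}"
  using assms
proof (induction n arbitrary: p)
  case 0
  then show ?case by (simp add: Psi_def standard_cycle_form_def cycle_sets_def)
next
  case (Suc n)
  have S: "{1..Suc n} = insert (Suc n) {1..n}" by auto
  from Suc.prems show ?case
  proof (cases rule: permutes_Suc_cases)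
    case 1
    then show ?thesis using Suc.IH[OF 1] S by (simp add: Psi_fixed_max)
  next
    case (2 p' a)
    then show ?thesis
      using Suc.IH[OF 2(1)] S unfolding 2(3) Psi_insert_max[OF 2(1,2)]
      by (simp add: distinct_insert_after set_insert_after)
  qed
qed

lemma length_Psi: "p permutes {1..n} \<Longrightarrow> length (Psi n p) = n"
  using Psi_enumerates[of p n] distinct_card[of "Psi n p"] by simp


section \<open>Occurrences created by a maximal letter\<close>

lemma finite_occurrences_121' [simp]: "finite (occurrences_121' w)"
  by (rule finite_subset[of _ "{..<length w} \<times> {..<length w} \<times> {..<length w}"])
    (auto simp: occurrences_121'_def)

text \<open>The outer letters of an occurrence lie below its middle letter, so \<open>N\<close> can
  only be in the middle, and there any letter before it and any letter after it will do. Triples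
  avoiding \<open>N\<close> are those of the word without \<open>N\<close>, with shifted
  positions.\<close>

lemma card_occurrences_insert_max:
  assumes "\<forall>x \<in> set us \<union> set vs. x < N"
  shows "card (occurrences_121' (us @ N # vs)) =
    card (occurrences_121' (us @ vs)) + length us * length vs"
proof -
  define l where "l = length us"
  define w where "w = us @ N # vs"
  define v where "v = us @ vs"
  \<comment> \<open>The increasing map from positions of \<open>us @ vs\<close> to positions of
    \<open>us @ N # vs\<close>; it skips exactly \<open>l\<close>, the position of
    \<open>N\<close>.\<close>
  define s where "s i = (if i < l then i else Suc i)" for i
  define h where "h = (\<lambda>(i, j, k). (s i, s j, s k))"
  define T where "T = {..<l} \<times> {l} \<times> {Suc l..<length w}"
  have s_less: "s i < s j \<longleftrightarrow> i < j" and s_ne: "s i \<noteq> l"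
    and s_len: "s i < length w \<longleftrightarrow> i < length v" for i j
    by (auto simp: s_def w_def v_def l_def)
  have s_onto: "\<exists>i'. i = s i'" if "i \<noteq> l" for i
    using that by (intro exI[of _ "if i < l then i else i - 1"]) (auto simp: s_def)
  have w_s: "w ! s i = v ! i" for i
    by (auto simp: s_def w_def v_def l_def nth_append Suc_diff_le)
  have w_l: "w ! l = N" by (simp add: w_def l_def)
  have w_lt: "w ! i < N" if "i < length w" "i \<noteq> l" for i
    using that assms by (auto simp: w_def l_def nth_append nth_Cons split: nat.splits)
  have mem_w: "(i, j, k) \<in> occurrences_121' w \<longleftrightarrow> (i, j, k) \<in> h ` occurrences_121' v \<union> T"
    for i j k
  proof
    assume o: "(i, j, k) \<in> occurrences_121' w"
    show "(i, j, k) \<in> h ` occurrences_121' v \<union> T"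
    proof (cases "j = l")
      case True
      then show ?thesis using o by (auto simp: occurrences_121'_def T_def)
    next
      case False
      \<comment> \<open>With a middle letter below \<open>N\<close>, both outer letters are below
        \<open>N\<close> as well, so all three positions are in the range of
        \<open>s\<close>.\<close>
      then have "w ! j < N" using o by (intro w_lt) (auto simp: occurrences_121'_def)
      then have "i \<noteq> l" "k \<noteq> l" using o w_l by (auto simp: occurrences_121'_def)
      then obtain i' j' k' where e: "i = s i'" "j = s j'" "k = s k'"
        using s_onto False by metis
      then have "(i', j', k') \<in> occurrences_121' v"
        using o by (simp add: occurrences_121'_def s_less s_len w_s)
      then have "h (i', j', k') \<in> h ` occurrences_121' v" by (rule imageI)
      then show ?thesis using e by (simp add: h_def)
    qed
  next
    assume "(i, j, k) \<in> h ` occurrences_121' v \<union> T"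
    then show "(i, j, k) \<in> occurrences_121' w"
    proof
      assume "(i, j, k) \<in> h ` occurrences_121' v"
      then show ?thesis by (auto simp: h_def occurrences_121'_def s_less s_len w_s)
    next
      assume t: "(i, j, k) \<in> T"
      moreover have "w ! i < N" "w ! k < N" using t
        by (auto simp: T_def w_def l_def intro!: w_lt[unfolded w_def l_def])
      ultimately show ?thesis by (auto simp: T_def occurrences_121'_def w_l)
    qed
  qed
  have "occurrences_121' w = h ` occurrences_121' v \<union> T"
    using mem_w by auto
  moreover have "h ` occurrences_121' v \<inter> T = {}"
    using s_ne by (auto simp: h_def T_def)
  moreover have "inj s" by (auto simp: inj_def s_def split: if_splits)
  then have "inj_on h (occurrences_121' v)" by (auto simp: h_def inj_on_def dest: injD)
  moreover have "finite T" by (simp add: T_def)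
  moreover have "card T = length us * length vs" by (simp add: T_def w_def l_def)
  ultimately show ?thesis
    by (simp add: card_Un_disjoint card_image flip: w_def v_def)
qed

section \<open>The recurrence for the counting function\<close>

text \<open>The letter \<open>a\<close> is the preimage of \<open>Suc n\<close> under the composite;
  once it is known, the transposition can be cancelled.\<close>

lemma permutes_insert_max_inject:
  assumes "p permutes {1..n}" "a \<in> {1..n}" "p' permutes {1..n}" "a' \<in> {1..n}"
    and eq: "p \<circ> transpose (Suc n) a = p' \<circ> transpose (Suc n) a'"
  shows "p = p' \<and> a = a'"
proof -
  have N: "p (Suc n) = Suc n" "p' (Suc n) = Suc n"
    using permutes_not_in[OF assms(1)] permutes_not_in[OF assms(3)] by auto
  have "(p \<circ> transpose (Suc n) a) a = Suc n" using N by simp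
  moreover have "(p \<circ> transpose (Suc n) a) a' = Suc n" unfolding eq using N by simp
  ultimately have "a = a'"
    using permutes_inj[OF permutes_insert_max[OF assms(1,2)]] by (metis injD)
  moreover from this have "p = p'"
    using arg_cong[OF eq, of "\<lambda>f. f \<circ> transpose (Suc n) a"] by (simp add: comp_assoc)
  ultimately show ?thesis by simp
qed

lemma f_121'_0: "f_121' k m 0 = (if k = 0 \<and> m = 0 then 1 else 0)"
proof -
  have "occurrences_121' (Psi 0 id) = {}"
    by (simp add: Psi_def standard_cycle_form_def cycle_sets_def occurrences_121'_def)
  then have "\<pi> permutes {1..0} \<and> card (cycle_sets 0 \<pi>) = m \<and>
      card (occurrences_121' (Psi 0 \<pi>)) = k \<longleftrightarrow> \<pi> = id \<and> k = 0 \<and> m = 0" for \<pi>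
    by (auto simp: cycle_sets_def)
  then show ?thesis by (simp add: f_121'_def)
qed

text \<open>The sum runs over the 0-based position \<open>i\<close> of \<open>a\<close> in the word,
  not over \<open>a\<close> itself. Insertion there leaves \<open>Suc i\<close> letters before the
  maximum and \<open>n - Suc i\<close> after it, whatever the permutation. A fixed maximum stands in
  front and creates no occurrence. The guards keep truncated subtraction from producing spurious
  terms.\<close>

lemma f_121'_Suc:
  "f_121' k m (Suc n) = (if m = 0 then 0 else f_121' k (m - 1) n) +
     (\<Sum>i<n. if Suc i * (n - Suc i) \<le> k then f_121' (k - Suc i * (n - Suc i)) m n else 0)"
proof -
  define occ where "occ n p = card (occurrences_121' (Psi n p))" for n p
  define cyc where "cyc n p = card (cycle_sets n p)" for n p
  define P where "P = {p. p permutes {1..n}}"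
  \<comment> \<open>The letter after which \<open>Suc n\<close> is inserted depends on
    \<open>p\<close>; fixing its position instead makes the number of new occurrences constant in
    \<open>p\<close>.\<close>
  define g where "g i p = p \<circ> transpose (Suc n) (Psi n p ! i)" for i p
  define F where "F = {p \<in> P. Suc (cyc n p) = m \<and> occ n p = k}"
  \<comment> \<open>The condition is additive, so it is empty by itself when the new occurrences
    alone exceed \<open>k\<close>.\<close>
  define B where "B i = {p \<in> P. cyc n p = m \<and> occ n p + Suc i * (n - Suc i) = k}" for i
  have finP: "finite P" unfolding P_def by (rule finite_permutations) simp
  have f: "f_121' k m n = card {p \<in> P. cyc n p = m \<and> occ n p = k}" for k m
    by (simp add: f_121'_def P_def cyc_def occ_def)
  have nth: "Psi n p ! i \<in> {1..n}" if "p \<in> P" "i < n" for p i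
    using that Psi_enumerates length_Psi nth_mem unfolding P_def by (metis mem_Collect_eq)
  have gperm: "g i p permutes {1..Suc n}" if "p \<in> P" "i < n" for i p
    unfolding g_def using that nth by (intro permutes_insert_max) (auto simp: P_def)
  have gcyc: "cyc (Suc n) (g i p) = cyc n p" if "p \<in> P" "i < n" for i p
    using that nth card_cycle_sets_insert_max by (simp add: g_def cyc_def P_def)
  have gocc: "occ (Suc n) (g i p) = occ n p + Suc i * (n - Suc i)" if "p \<in> P" "i < n" for i p
  proof -
    have p: "p permutes {1..n}" using that by (simp add: P_def)
    let ?w = "Psi n p"
    have w: "distinct ?w" "set ?w = {1..n}" "length ?w = n"
      using Psi_enumerates[OF p] length_Psi[OF p] by auto
    have "\<forall>x \<in> set (take (Suc i) ?w) \<union> set (drop (Suc i) ?w). x < Suc n"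
      using w(2) by (auto dest!: in_set_takeD in_set_dropD)
    then have "card (occurrences_121' (take (Suc i) ?w @ Suc n # drop (Suc i) ?w)) =
        card (occurrences_121' ?w) + Suc i * (n - Suc i)"
      using w that by (simp only: card_occurrences_insert_max append_take_drop_id length_take
        length_drop) simp
    then show ?thesis
      unfolding occ_def g_def Psi_insert_max[OF p nth[OF that]]
      using insert_after_nth[of ?w i "Suc n"] w that by simp
  qed
  have fcyc: "cyc (Suc n) p = Suc (cyc n p)" if "p \<in> P" for p
  proof -
    have p: "p permutes {1..n}" using that by (simp add: P_def)
    have "{Suc n} \<notin> cycle_sets n p" using cycle_sets_subset(1)[OF p, of "{Suc n}"] by auto
    then show ?thesis by (simp add: cyc_def cycle_sets_fixed_max[OF p])
  qed
  have focc: "occ (Suc n) p = occ n p" if "p \<in> P" for p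
  proof -
    have p: "p permutes {1..n}" using that by (simp add: P_def)
    show ?thesis
      using card_occurrences_insert_max[of "[]" "Psi n p" "Suc n"] Psi_enumerates[OF p]
      by (simp add: occ_def Psi_fixed_max[OF p])
  qed
  have set_eq: "{p. p permutes {1..Suc n} \<and> cyc (Suc n) p = m \<and> occ (Suc n) p = k} =
      F \<union> (\<Union>i<n. g i ` B i)" (is "?L = ?R")
  proof (intro equalityI subsetI)
    fix q assume q: "q \<in> ?L"
    then have "q permutes {1..Suc n}" by simp
    then show "q \<in> ?R"
    proof (cases rule: permutes_Suc_cases)
      case 1
      then show ?thesis using q fcyc focc by (auto simp: F_def P_def)
    next
      case (2 p a)
      then have p: "p \<in> P" by (simp add: P_def)
      have "a \<in> set (Psi n p)" using 2 Psi_enumerates by simp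
      then obtain i where i: "i < n" "a = Psi n p ! i"
        using length_Psi[OF 2(1)] by (auto simp: in_set_conv_nth)
      then have "q = g i p" using 2 by (simp add: g_def)
      moreover have "p \<in> B i" using q gcyc[OF p i(1)] gocc[OF p i(1)] p
        unfolding \<open>q = g i p\<close> B_def by simp
      ultimately show ?thesis using i by blast
    qed
  next
    fix q assume "q \<in> ?R"
    then consider "q \<in> F" | i p where "i < n" "p \<in> B i" "q = g i p" by blast
    then show "q \<in> ?L"
    proof cases
      case 1
      then show ?thesis
        using fcyc focc permutes_subset[of q "{1..n}" "{1..Suc n}"] by (auto simp: F_def P_def)
    next
      case 2
      then show ?thesis using gcyc gocc gperm by (simp add: B_def)
    qed
  qed
  \<comment> \<open>Equal images have equal \<open>p\<close> and equal letters; since the word of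
    \<open>p\<close> is distinct, the positions agree too.\<close>
  have ginj: "p = p' \<and> i = i'"
    if "p \<in> P" "p' \<in> P" "i < n" "i' < n" "g i p = g i' p'" for p p' i i'
  proof -
    have pp: "p permutes {1..n}" "p' permutes {1..n}" using that by (auto simp: P_def)
    have *: "p = p' \<and> Psi n p ! i = Psi n p' ! i'"
      using pp(1) nth[OF that(1,3)] pp(2) nth[OF that(2,4)] that(5)[unfolded g_def]
      by (rule permutes_insert_max_inject)
    then show ?thesis
      using Psi_enumerates[OF pp(1)] length_Psi[OF pp(1)] that(3,4) nth_eq_iff_index_eq by metis
  qed
  have finF: "finite F" and finB: "\<And>i. finite (B i)"
    using finP by (auto simp: F_def B_def)
  \<comment> \<open>Members of \<open>F\<close> fix \<open>Suc n\<close>, whereas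
    \<open>g i p\<close> takes a letter of \<open>{1..n}\<close> to \<open>Suc n\<close>.\<close>
  have disj: "F \<inter> (\<Union>i<n. g i ` B i) = {}"
  proof -
    have "g i p \<notin> P" if "p \<in> P" "i < n" for i p
    proof
      assume "g i p \<in> P"
      then have "g i p (Suc n) = Suc n" by (auto simp: P_def intro: permutes_not_in)
      moreover have "g i p (Psi n p ! i) = Suc n"
        using that permutes_not_in[of p "{1..n}" "Suc n"] by (simp add: g_def P_def)
      ultimately have "Psi n p ! i = Suc n"
        using permutes_inj[OF gperm[OF that]] by (metis injD)
      then show False using nth[OF that] by simp
    qed
    then show ?thesis by (auto simp: F_def B_def)
  qed
  have cardB: "card (B i) =
      (if Suc i * (n - Suc i) \<le> k then f_121' (k - Suc i * (n - Suc i)) m n else 0)"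
    for i
  proof (cases "Suc i * (n - Suc i) \<le> k")
    case True
    then have "B i = {p \<in> P. cyc n p = m \<and> occ n p = k - Suc i * (n - Suc i)}"
      unfolding B_def by (intro Collect_cong) (auto simp del: mult_Suc)
    then show ?thesis using True f by simp
  next
    case False
    then have "B i = {}" unfolding B_def by (auto simp del: mult_Suc)
    then show ?thesis using False by (simp del: mult_Suc)
  qed
  have "f_121' k m (Suc n) = card (F \<union> (\<Union>i<n. g i ` B i))"
    unfolding set_eq[symmetric] by (simp add: f_121'_def cyc_def occ_def)
  also have "\<dots> = card F + card (\<Union>i<n. g i ` B i)"
    using finF finB disj by (intro card_Un_disjoint) auto
  also have "card (\<Union>i<n. g i ` B i) = (\<Sum>i<n. card (g i ` B i))"
  proof (rule card_UN_disjoint)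
    show "\<forall>i\<in>{..<n}. \<forall>j\<in>{..<n}. i \<noteq> j \<longrightarrow> g i ` B i \<inter> g j ` B j = {}"
      using ginj by (fastforce simp: B_def)
  qed (use finB in auto)
  also have "(\<Sum>i<n. card (g i ` B i)) = (\<Sum>i<n. card (B i))"
  proof (rule sum.cong[OF refl], rule card_image, rule inj_onI)
    fix i p p' assume "i \<in> {..<n}" "p \<in> B i" "p' \<in> B i" "g i p = g i p'"
    then show "p = p'" using ginj[of p p' i i] by (simp add: B_def)
  qed
  also have "\<dots> =
      (\<Sum>i<n. if Suc i * (n - Suc i) \<le> k then f_121' (k - Suc i * (n - Suc i)) m n else 0)"
    by (simp only: cardB)
  also have "card F = (if m = 0 then 0 else f_121' k (m - 1) n)"
  proof (cases m)
    case 0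
    then show ?thesis by (simp add: F_def)
  next
    case (Suc m')
    then show ?thesis by (simp add: F_def f)
  qed
  finally show ?thesis .
qed

section \<open>Solving the recurrence for zero, one and two occurrences\<close>

text \<open>Insertion at the very end of the word creates no occurrence; this last summand is split
  off as \<open>f_121' k m (Suc n)\<close>.\<close>

lemma f_121'_Suc_Suc:
  "f_121' k m (Suc (Suc n)) =
     (if m = 0 then 0 else f_121' k (m - 1) (Suc n)) + f_121' k m (Suc n) +
     (\<Sum>i<n. if Suc i * (n - i) \<le> k then f_121' (k - Suc i * (n - i)) m (Suc n) else 0)"
  by (subst f_121'_Suc) (simp del: mult_Suc cong: if_cong)

text \<open>Insertion anywhere but at the end creates at least \<open>n\<close> occurrences, too
  many when \<open>k < n\<close>; for \<open>n = 0\<close> the sum is empty. What remains has the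
  shape of Pascal's rule.\<close>

lemma f_121'_Suc_Suc_small:
  assumes "k < n \<or> n = 0"
  shows "f_121' k m (Suc (Suc n)) =
    (if m = 0 then 0 else f_121' k (m - 1) (Suc n)) + f_121' k m (Suc n)"
proof -
  have "\<not> Suc i * (n - i) \<le> k" if "i < n" for i
  proof -
    \<comment> \<open>The product becomes \<open>(i + 1) * (d + 1)\<close>, which is at least
      \<open>i + d + 1 = n\<close>.\<close>
    obtain d where d: "n = Suc (i + d)" using \<open>i < n\<close> less_iff_Suc_add by auto
    have "n \<le> Suc i * (n - i)" by (simp add: d)
    then show ?thesis using assms that by simp
  qed
  then have "(\<Sum>i<n. if Suc i * (n - i) \<le> k then f_121' (k - Suc i * (n - i)) m (Suc n) else 0) = 0"
    by (intro sum.neutral) (simp del: mult_Suc)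
  then show ?thesis unfolding f_121'_Suc_Suc by simp
qed

lemma f_121'_1: "f_121' k m (Suc 0) = (if k = 0 \<and> m = 1 then 1 else 0)"
  by (auto simp: f_121'_Suc f_121'_0)

text \<open>Pascal's rule in the form the recurrence yields. The guard matters at
  \<open>m = 1\<close>, where \<open>m - 1 - 1\<close> truncates to 0 and the binomial would be
  1.\<close>

lemma choose_pred_Suc:
  "m \<noteq> 0 \<Longrightarrow> (if m - 1 = 0 then 0 else n choose (m - 1 - 1)) + (n choose (m - 1)) = Suc n choose (m - 1)"
  by (cases "m - 1") auto

text \<open>Including \<open>m = 0\<close> with value 0 lets the induction hypothesis be applied at
  \<open>m - 1\<close>.\<close>

lemma f_121'_no_occurrence:
  "f_121' 0 m (Suc n) = (if m = 0 then 0 else n choose (m - 1))"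
proof (induction n arbitrary: m)
  case 0
  then show ?case by (auto simp: f_121'_1 binomial_eq_0)
next
  case (Suc n)
  have "f_121' 0 m (Suc (Suc n)) = (if m = 0 then 0 else f_121' 0 (m - 1) (Suc n)) + f_121' 0 m (Suc n)"
    by (rule f_121'_Suc_Suc_small) auto
  then show ?case using choose_pred_Suc[of m n] by (simp only: Suc.IH) auto
qed

lemma f_121'_2: "0 < k \<Longrightarrow> f_121' k m (Suc (Suc 0)) = 0"
  by (simp add: f_121'_Suc_Suc f_121'_1)

lemma f_121'_one_occurrence:
  "f_121' 1 m (Suc (Suc (Suc n))) = (if m = 0 then 0 else Suc n choose (m - 1))"
proof (induction n arbitrary: m)
  case 0
  \<comment> \<open>At size 3 the only insertion before the end has weight \<open>1 * 1\<close>,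
    which reduces the count to words of size 2 without occurrences. From size 4 on, Pascal's rule
    takes over.\<close>
  have "f_121' 1 m (Suc (Suc (Suc 0))) = f_121' 0 m (Suc (Suc 0))"
    by (subst f_121'_Suc_Suc) (simp add: f_121'_2)
  then show ?case by (simp add: f_121'_no_occurrence)
next
  case (Suc n)
  have "f_121' 1 m (Suc (Suc (Suc (Suc n)))) =
    (if m = 0 then 0 else f_121' 1 (m - 1) (Suc (Suc (Suc n)))) + f_121' 1 m (Suc (Suc (Suc n)))"
    by (rule f_121'_Suc_Suc_small) auto
  then show ?case using choose_pred_Suc[of m "Suc n"] by (simp only: Suc.IH) auto
qed

lemma f_121'_two_occurrences:
  "f_121' 2 m (Suc (Suc (Suc (Suc n)))) = (if m = 0 then 0 else 2 * (Suc (Suc n) choose (m - 1)))"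
proof (induction n arbitrary: m)
  case 0
  \<comment> \<open>The weight 1 available at size 3 would leave one occurrence in a word of size 2,
    which is impossible.\<close>
  have "f_121' 2 m (Suc (Suc (Suc 0))) = 0" for m
    by (subst f_121'_Suc_Suc) (simp add: f_121'_2)
  \<comment> \<open>The factor 2 arises here: at size 4 the two insertions before the end have
    weights \<open>1 * 2\<close> and \<open>2 * 1\<close>, both equal to 2.\<close>
  then have "f_121' 2 m (Suc (Suc (Suc (Suc 0)))) = 2 * f_121' 0 m (Suc (Suc (Suc 0)))"
    by (subst f_121'_Suc_Suc) (simp add: numeral_2_eq_2)
  then show ?case by (simp add: f_121'_no_occurrence)
next
  case (Suc n)
  have "f_121' 2 m (Suc (Suc (Suc (Suc (Suc n))))) =
    (if m = 0 then 0 else f_121' 2 (m - 1) (Suc (Suc (Suc (Suc n))))) +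
    f_121' 2 m (Suc (Suc (Suc (Suc n))))"
    by (rule f_121'_Suc_Suc_small) auto
  then show ?case using choose_pred_Suc[of m "Suc (Suc n)"] by (simp only: Suc.IH) auto
qed

theorem mainTheorem19:
  shows "(\<forall>m n. 1 \<le> n \<and> 1 \<le> m \<and> m \<le> n \<longrightarrow> f_121' 0 m n = (n - 1) choose (m - 1)) \<and>
         (\<forall>m n. 3 \<le> n \<and> 1 \<le> m \<and> m \<le> n - 1 \<longrightarrow> f_121' 1 m n = (n - 2) choose (m - 1)) \<and>
         (\<forall>m n. 4 \<le> n \<and> 1 \<le> m \<and> m \<le> n - 1 \<longrightarrow> f_121' 2 m n = 2 * ((n - 2) choose (m - 1)))"
proof (intro conjI allI impI)
  fix m n :: nat assume "1 \<le> n \<and> 1 \<le> m \<and> m \<le> n"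
  then show "f_121' 0 m n = (n - 1) choose (m - 1)"
    using f_121'_no_occurrence[of m "n - 1"] by simp
next
  fix m n :: nat assume "3 \<le> n \<and> 1 \<le> m \<and> m \<le> n - 1"
  then obtain n' where "n = Suc (Suc (Suc n'))" "m \<noteq> 0"
    by (auto simp: numeral_3_eq_3 Suc_le_eq gr0_conv_Suc less_iff_Suc_add)
  then show "f_121' 1 m n = (n - 2) choose (m - 1)"
    using f_121'_one_occurrence[of m n'] by simp
next
  fix m n :: nat assume "4 \<le> n \<and> 1 \<le> m \<and> m \<le> n - 1"
  then obtain n' where "n = Suc (Suc (Suc (Suc n')))" "m \<noteq> 0"
    using nat_le_iff_add[of 4 n] by auto
  then show "f_121' 2 m n = 2 * ((n - 2) choose (m - 1))"
    using f_121'_two_occurrences[of m n'] by simp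
qed

end
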